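(* Let $\mathsf{CS}$ be an arbitrary constant specification for $\mathsf{JE}$. For every formula $F$: $\mathsf{JE}_{\mathsf{CS}}\vdash F$ if and only if $\mathcal M\Vdash F$ for every $\mathsf{JE}_{\mathsf{CS}}$ modular model $\mathcal M$.
   Context: Language. Fix countably many proof constants $\alpha_i$, proof variables $\xi_i$, and a countable set $\mathsf{Prop}$ of atomic propositions. Proof terms: $\lambda ::= \alpha_i \mid \xi_i \mid (\lambda\cdot\lambda) \mid (\lambda+\lambda) \mid\ !\lambda$ (set $\mathsf{PTm}$). Justification terms: $t ::= \mathsf{e}(\lambda)$, $\lambda\in\mathsf{PTm}$ (set $\mathsf{JTm}$). Formulas: $F ::= P \mid \bot \mid (F\to F) \mid \lambda:F \mid [t]F$ (set $\mathsf{Fm}$); $\neg,\wedge,\vee,\leftrightarrow$ are classical abbreviations. Axioms of $\mathsf{JE}$: all instances of classical propositional tautologies, and all instances of (j) $\lambda:(F\to G)\to(\kappa:F\to\lambda\cdot\kappa:G)$; (j+$_1$) $(\lambda:F\vee\kappa:F)\to(\lambda+\kappa):F$; (jt) $\lambda:F\to F$; (j4) $\lambda:F\to\ !\lambda:\lambda:F$; (je) $(\lambda:(F\to G)\wedge\lambda:(G\to F))\to([\mathsf{e}(\lambda)]F\to[\mathsf{e}(\lambda)]G)$; (je+) $([\mathsf{e}(\lambda)]F\vee[\mathsf{e}(\kappa)]F)\to[\mathsf{e}(\lambda+\kappa)]F$. A constant specification $\mathsf{CS}$ is a set of pairs $(\alpha,A)$, $\alpha$ a proof constant, $A$ an axiom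 of $\mathsf{JE}$. $\mathsf{JE}_{\mathsf{CS}}$ is the Hilbert system with the axioms of $\mathsf{JE}$, modus ponens, and axiom necessitation (infer $\alpha:A$ whenever $(\alpha,A)\in\mathsf{CS}$). Basic evaluations. For sets of formulas $X,Y$: $\lambda:X=\{\lambda:F\mid F\in X\}$; $X\cdot Y=\{F\mid G\to F\in X\text{ for some }G\in Y\}$; $X\odot Y=\{F\mid F\to G\in X\text{ and }G\to F\in X\text{ for some }G\in Y\}$. A basic evaluation is a map $\varepsilon$ with $\varepsilon(P)\in\{0,1\}$ for $P\in\mathsf{Prop}$ and $\varepsilon:\mathsf{PTm}\cup\mathsf{JTm}\to\mathcal P(\mathsf{Fm})$ such that for all $\lambda,\kappa\in\mathsf{PTm}$: $\varepsilon(\lambda)\cdot\varepsilon(\kappa)\subseteq\varepsilon(\lambda\cdot\kappa)$; $\varepsilon(\lambda)\cup\varepsilon(\kappa)\subseteq\varepsilon(\lambda+\kappa)$; $F\in\varepsilon(\lambda)$ if $(\lambda,F)\in\mathsf{CS}$; $\lambda:\varepsilon(\lambda)\subseteq\varepsilon(!\lambda)$; $\varepsilon(\lambda)\odot\varepsilon(\mathsf{e}(\lambda))\subseteq\varepsilon(\mathsf{e}(\lambda))$; $\varepsilon(\mathsf{e}(\lambda))\cup\varepsilon(\mathsf{e}(\kappa))\subseteq\varepsilon(\mathsf{e}(\lambda+\kappa))$. Modular models. A quasi-model is $\mathcal M=\langle W,N,\varepsilon\rangle$ with $W\neq\emptyset$, $N:W\to\mathcal P(\mathcal P(W))$, and $\varepsilon$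 assigning to each $w\in W$ a basic evaluation $\varepsilon_w$. Truth: $\mathcal M,w\nVdash\bot$; $\mathcal M,w\Vdash P$ iff $\varepsilon_w(P)=1$; $\mathcal M,w\Vdash F\to G$ iff $\mathcal M,w\nVdash F$ or $\mathcal M,w\Vdash G$; $\mathcal M,w\Vdash\lambda:F$ iff $F\in\varepsilon_w(\lambda)$; $\mathcal M,w\Vdash[t]F$ iff $F\in\varepsilon_w(t)$. $\mathcal M\Vdash F$ means $\mathcal M,w\Vdash F$ for all $w\in W$. Truth set $|F|^{\mathcal M}=\{w\in W\mid\mathcal M,w\Vdash F\}$. A $\mathsf{JE}_{\mathsf{CS}}$ modular model is a quasi-model that is factive ($\mathcal M,w\Vdash\lambda:F$ implies $\mathcal M,w\Vdash F$ for all $w,\lambda,F$) and satisfies "justification yields belief": for all $t\in\mathsf{JTm}$, $w\in W$ and formulas $F$, $F\in\varepsilon_w(t)$ implies $|F|^{\mathcal M}\in N(w)$. *)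

theory Defs
  imports Main "HOL-Library.Countable"
begin

datatype ptm =
    PConst nat
  | PVar nat
  | App ptm ptm (infixl "\<cdot>" 75)
  | Plus ptm ptm (infixl "\<^bold>+" 70)
  | Bang ptm

datatype jtm = E ptm

datatype 'p fm =
    Atom 'p
  | Falsum
  | Imp "'p fm" "'p fm" (infixr "\<^bold>\<rightarrow>" 45)
  | Prf ptm "'p fm"
  | Just jtm "'p fm"

abbreviation Neg :: "'p fm \<Rightarrow> 'p fm" where
  "Neg F \<equiv> F \<^bold>\<rightarrow> Falsum"

abbreviation Or :: "'p fm \<Rightarrow> 'p fm \<Rightarrow> 'p fm" (infixr "\<^bold>\<or>" 50) where
  "F \<^bold>\<or> G \<equiv> Neg F \<^bold>\<rightarrow> G"

abbreviation And :: "'p fm \<Rightarrow> 'p fm \<Rightarrow> 'p fm" (infixr "\<^bold>\<and>" 55) where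
  "F \<^bold>\<and> G \<equiv> Neg (F \<^bold>\<rightarrow> Neg G)"


text \<open>Instances of classical tautologies: uniform substitutions, into the full language,
  of purely propositional formulas over an infinite supply of schematic letters.\<close>

datatype pf = Letter nat | PFalsum | PImp pf pf

primrec pf_eval :: "(nat \<Rightarrow> bool) \<Rightarrow> pf \<Rightarrow> bool" where
  "pf_eval v (Letter n) = v n"
| "pf_eval v PFalsum = False"
| "pf_eval v (PImp A B) = (pf_eval v A \<longrightarrow> pf_eval v B)"

primrec pf_subst :: "(nat \<Rightarrow> 'p fm) \<Rightarrow> pf \<Rightarrow> 'p fm" where
  "pf_subst \<sigma> (Letter n) = \<sigma> n"
| "pf_subst \<sigma> PFalsum = Falsum"
| "pf_subst \<sigma> (PImp A B) = (pf_subst \<sigma> A \<^bold>\<rightarrow> pf_subst \<sigma> B)"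

definition taut_instance :: "'p fm \<Rightarrow> bool" where
  "taut_instance F \<longleftrightarrow> (\<exists>A \<sigma>. (\<forall>v. pf_eval v A) \<and> F = pf_subst \<sigma> A)"

inductive JE_axiom :: "'p fm \<Rightarrow> bool" where
  taut: "taut_instance F \<Longrightarrow> JE_axiom F"
| j: "JE_axiom (Prf l (F \<^bold>\<rightarrow> G) \<^bold>\<rightarrow> (Prf k F \<^bold>\<rightarrow> Prf (l \<cdot> k) G))"
| jplus: "JE_axiom ((Prf l F \<^bold>\<or> Prf k F) \<^bold>\<rightarrow> Prf (l \<^bold>+ k) F)"
| jt: "JE_axiom (Prf l F \<^bold>\<rightarrow> F)"
| j4: "JE_axiom (Prf l F \<^bold>\<rightarrow> Prf (Bang l) (Prf l F))"
| je: "JE_axiom ((Prf l (F \<^bold>\<rightarrow> G) \<^bold>\<and> Prf l (G \<^bold>\<rightarrow> F))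
        \<^bold>\<rightarrow> (Just (E l) F \<^bold>\<rightarrow> Just (E l) G))"
| jeplus: "JE_axiom ((Just (E l) F \<^bold>\<or> Just (E k) F) \<^bold>\<rightarrow> Just (E (l \<^bold>+ k)) F)"

type_synonym 'p cs = "(ptm \<times> 'p fm) set"

definition constant_specification :: "'p cs \<Rightarrow> bool" where
  "constant_specification CS \<longleftrightarrow> (\<forall>(l, A) \<in> CS. (\<exists>i. l = PConst i) \<and> JE_axiom A)"

inductive JE_provable :: "'p cs \<Rightarrow> 'p fm \<Rightarrow> bool" ("_ \<turnstile>\<^sub>J\<^sub>E _" [50, 40] 40) for CS where
  Ax: "JE_axiom F \<Longrightarrow> CS \<turnstile>\<^sub>J\<^sub>E F"
| MP: "CS \<turnstile>\<^sub>J\<^sub>E F \<^bold>\<rightarrow> G \<Longrightarrow> CS \<turnstile>\<^sub>J\<^sub>E F \<Longrightarrow> CS \<turnstile>\<^sub>J\<^sub>E G"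
| AN: "(l, A) \<in> CS \<Longrightarrow> CS \<turnstile>\<^sub>J\<^sub>E Prf l A"


definition fm_app :: "'p fm set \<Rightarrow> 'p fm set \<Rightarrow> 'p fm set" where
  "fm_app X Y = {F. \<exists>G \<in> Y. (G \<^bold>\<rightarrow> F) \<in> X}"

definition fm_odot :: "'p fm set \<Rightarrow> 'p fm set \<Rightarrow> 'p fm set" where
  "fm_odot X Y = {F. \<exists>G \<in> Y. (F \<^bold>\<rightarrow> G) \<in> X \<and> (G \<^bold>\<rightarrow> F) \<in> X}"

text \<open>An evaluation is split into its components on atomic propositions, proof terms and
  justification terms.\<close>

record 'p evaluation =
  val :: "'p \<Rightarrow> bool"
  pev :: "ptm \<Rightarrow> 'p fm set"
  jev :: "jtm \<Rightarrow> 'p fm set"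

definition basic_evaluation :: "'p cs \<Rightarrow> 'p evaluation \<Rightarrow> bool" where
  "basic_evaluation CS \<epsilon> \<longleftrightarrow>
     (\<forall>l k. fm_app (pev \<epsilon> l) (pev \<epsilon> k) \<subseteq> pev \<epsilon> (l \<cdot> k)) \<and>
     (\<forall>l k. pev \<epsilon> l \<union> pev \<epsilon> k \<subseteq> pev \<epsilon> (l \<^bold>+ k)) \<and>
     (\<forall>l F. (l, F) \<in> CS \<longrightarrow> F \<in> pev \<epsilon> l) \<and>
     (\<forall>l. Prf l ` pev \<epsilon> l \<subseteq> pev \<epsilon> (Bang l)) \<and>
     (\<forall>l. fm_odot (pev \<epsilon> l) (jev \<epsilon> (E l)) \<subseteq> jev \<epsilon> (E l)) \<and>
     (\<forall>l k. jev \<epsilon> (E l) \<union> jev \<epsilon> (E k) \<subseteq> jev \<epsilon> (E (l \<^bold>+ k)))"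

text \<open>The set of worlds is an arbitrary nonempty subset of the type; the values of
  \<open>nbhd\<close> and \<open>evl\<close> outside it are irrelevant.\<close>

record ('w, 'p) model =
  worlds :: "'w set"
  nbhd :: "'w \<Rightarrow> 'w set set"
  evl :: "'w \<Rightarrow> 'p evaluation"

definition quasi_model :: "'p cs \<Rightarrow> ('w, 'p) model \<Rightarrow> bool" where
  "quasi_model CS M \<longleftrightarrow>
     worlds M \<noteq> {} \<and>
     (\<forall>w \<in> worlds M. nbhd M w \<subseteq> Pow (worlds M)) \<and>
     (\<forall>w \<in> worlds M. basic_evaluation CS (evl M w))"

primrec holds :: "('w, 'p) model \<Rightarrow> 'w \<Rightarrow> 'p fm \<Rightarrow> bool" where
  "holds M w (Atom P) = val (evl M w) P"
| "holds M w Falsum = False"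
| "holds M w (F \<^bold>\<rightarrow> G) = (\<not> holds M w F \<or> holds M w G)"
| "holds M w (Prf l F) = (F \<in> pev (evl M w) l)"
| "holds M w (Just t F) = (F \<in> jev (evl M w) t)"

definition valid_in :: "('w, 'p) model \<Rightarrow> 'p fm \<Rightarrow> bool" where
  "valid_in M F \<longleftrightarrow> (\<forall>w \<in> worlds M. holds M w F)"

definition truth_set :: "('w, 'p) model \<Rightarrow> 'p fm \<Rightarrow> 'w set" where
  "truth_set M F = {w \<in> worlds M. holds M w F}"

definition factive :: "('w, 'p) model \<Rightarrow> bool" where
  "factive M \<longleftrightarrow> (\<forall>w \<in> worlds M. \<forall>l F. holds M w (Prf l F) \<longrightarrow> holds M w F)"

definition justification_yields_belief :: "('w, 'p) model \<Rightarrow> bool" where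
  "justification_yields_belief M \<longleftrightarrow>
     (\<forall>t. \<forall>w \<in> worlds M. \<forall>F. F \<in> jev (evl M w) t \<longrightarrow> truth_set M F \<in> nbhd M w)"

definition modular_model :: "'p cs \<Rightarrow> ('w, 'p) model \<Rightarrow> bool" where
  "modular_model CS M \<longleftrightarrow>
     quasi_model CS M \<and> factive M \<and> justification_yields_belief M"

end

(*
  Completeness needs only models with a single world: given an unprovable F, take a set of
  formulas that is maximal among those not deriving F and read the basic evaluation off from it.
  With the full neighbourhood system on that world, justification yields belief trivially.
  This is why the type of worlds may be arbitrary.
*)
theory Submission imports Defs begin

text \<open>Truth at a world is itself a propositional valuation of the schematic letters, so
  tautology instances hold even when \<open>Prf\<close> and \<open>Just\<close> formulas are
  substituted.\<close>

lemma holds_pf_subst: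
  "holds M w (pf_subst \<sigma> A) \<longleftrightarrow> pf_eval (\<lambda>n. holds M w (\<sigma> n)) A"
  by (induction A) auto

lemma JE_axiom_sound:
  assumes "modular_model CS M" "w \<in> worlds M" "JE_axiom F"
  shows "holds M w F"
proof -
  have ev: "basic_evaluation CS (evl M w)" and
    fac: "F \<in> pev (evl M w) l \<Longrightarrow> holds M w F" for l F
    using assms(1,2) by (auto simp: modular_model_def quasi_model_def factive_def)
  from assms(3) show ?thesis
  proof cases
    case taut
    then show ?thesis by (auto simp: taut_instance_def holds_pf_subst)
  next
    case (jt l G)
    then show ?thesis using fac[of G l] by auto
  \<comment> \<open>Each remaining axiom scheme is the object-language form of one closure condition
    on a basic evaluation.\<close>
  qed (use ev in \<open>fastforce simp: basic_evaluation_def fm_app_def fm_odot_def\<close>)+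
qed

lemma JE_sound:
  assumes "CS \<turnstile>\<^sub>J\<^sub>E F" "modular_model CS M"
  shows "valid_in M F"
  using assms(1)
proof induction
  case (Ax F)
  then show ?case using JE_axiom_sound[OF assms(2)] by (auto simp: valid_in_def)
next
  case (AN l A)
  then show ?case
    using assms(2)
    by (auto simp: valid_in_def modular_model_def quasi_model_def basic_evaluation_def)
qed (auto simp: valid_in_def)

text \<open>Necessitation is confined to \<open>provable\<close>, so the deduction theorem has only
  modus ponens to carry through.\<close>

inductive derives :: "'p cs \<Rightarrow> 'p fm set \<Rightarrow> 'p fm \<Rightarrow> bool" for CS \<Gamma> where
  provable: "CS \<turnstile>\<^sub>J\<^sub>E F \<Longrightarrow> derives CS \<Gamma> F"
| assumption: "F \<in> \<Gamma> \<Longrightarrow> derives CS \<Gamma> F"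
| mp: "derives CS \<Gamma> (F \<^bold>\<rightarrow> G) \<Longrightarrow> derives CS \<Gamma> F \<Longrightarrow> derives CS \<Gamma> G"

lemma derives_empty: "derives CS {} F \<Longrightarrow> CS \<turnstile>\<^sub>J\<^sub>E F"
  by (induction rule: derives.induct) (auto intro: JE_provable.MP)

lemma derives_mono: "derives CS \<Gamma> F \<Longrightarrow> \<Gamma> \<subseteq> \<Delta> \<Longrightarrow> derives CS \<Delta> F"
  by (induction rule: derives.induct) (auto intro: derives.intros)

text \<open>This is the finiteness of derivations in the form Zorn's lemma asks for: at modus ponens
  the two members found are comparable, and the larger one derives both premises.\<close>

lemma derives_Union_chain:
  assumes "derives CS (\<Union>\<C>) F" "\<C> \<noteq> {}" "subset.chain \<A> \<C>"
  shows "\<exists>\<Gamma>\<in>\<C>. derives CS \<Gamma> F"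
  using assms(1)
proof induction
  case (mp F G)
  then obtain \<Gamma> \<Delta> where *: "\<Gamma> \<in> \<C>" "\<Delta> \<in> \<C>" "derives CS \<Gamma> (F \<^bold>\<rightarrow> G)" "derives CS \<Delta> F"
    by blast
  moreover have "\<Gamma> \<subseteq> \<Delta> \<or> \<Delta> \<subseteq> \<Gamma>"
    using assms(3) *(1,2) by (meson subset_chain_def)
  ultimately show ?case by (meson derives.mp derives_mono)
qed (use assms(2) in \<open>auto intro: derives.intros\<close>)

lemma derives_taut:
  assumes "\<And>v. pf_eval v A"
  shows "derives CS \<Gamma> (pf_subst \<sigma> A)"
proof -
  have "taut_instance (pf_subst \<sigma> A)"
    unfolding taut_instance_def using assms by blast
  then show ?thesis by (intro derives.provable JE_provable.Ax JE_axiom.taut)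
qed

lemma derives_K: "derives CS \<Gamma> (F \<^bold>\<rightarrow> G \<^bold>\<rightarrow> F)"
  using derives_taut[of "PImp (Letter 0) (PImp (Letter 1) (Letter 0))" CS \<Gamma>
      "\<lambda>n. if n = 0 then F else G"]
  by simp

lemma derives_S: "derives CS \<Gamma> ((F \<^bold>\<rightarrow> G \<^bold>\<rightarrow> H) \<^bold>\<rightarrow> (F \<^bold>\<rightarrow> G) \<^bold>\<rightarrow> F \<^bold>\<rightarrow> H)"
  using derives_taut[of "PImp (PImp (Letter 0) (PImp (Letter 1) (Letter 2)))
        (PImp (PImp (Letter 0) (Letter 1)) (PImp (Letter 0) (Letter 2)))" CS \<Gamma>
      "\<lambda>n. if n = 0 then F else if n = 1 then G else H"]
  by simp

lemma derives_cases:
  "derives CS \<Gamma> ((F \<^bold>\<rightarrow> H) \<^bold>\<rightarrow> ((F \<^bold>\<rightarrow> G) \<^bold>\<rightarrow> H) \<^bold>\<rightarrow> H)"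
  using derives_taut[of "PImp (PImp (Letter 0) (Letter 2))
        (PImp (PImp (PImp (Letter 0) (Letter 1)) (Letter 2)) (Letter 2))" CS \<Gamma>
      "\<lambda>n. if n = 0 then F else if n = 1 then G else H"]
  by (simp, blast)

lemma derives_refl: "derives CS \<Gamma> (F \<^bold>\<rightarrow> F)"
  using derives_taut[of "PImp (Letter 0) (Letter 0)" CS \<Gamma> "\<lambda>_. F"] by simp

lemma derives_exfalso: "derives CS \<Gamma> (Falsum \<^bold>\<rightarrow> F)"
  using derives_taut[of "PImp PFalsum (Letter 0)" CS \<Gamma> "\<lambda>_. F"] by simp

lemma deduction: "derives CS (insert F \<Gamma>) G \<Longrightarrow> derives CS \<Gamma> (F \<^bold>\<rightarrow> G)"
proof (induction rule: derives.induct)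
  case (provable G)
  then show ?case by (meson derives.provable derives.mp derives_K)
next
  case (assumption G)
  then show ?case by (metis derives.assumption derives.mp derives_K derives_refl insertE)
next
  case (mp G H)
  then show ?case by (meson derives.mp derives_S)
qed

text \<open>Avoiding \<open>F\<close> takes the place of consistency, so the negation of
  \<open>F\<close> need not be adjoined. Consistency follows by ex falso.\<close>

definition maximal_avoiding :: "'p cs \<Rightarrow> 'p fm \<Rightarrow> 'p fm set \<Rightarrow> bool" where
  "maximal_avoiding CS F \<Gamma> \<longleftrightarrow>
     \<not> derives CS \<Gamma> F \<and> (\<forall>\<Delta>. \<Gamma> \<subseteq> \<Delta> \<longrightarrow> \<not> derives CS \<Delta> F \<longrightarrow> \<Delta> = \<Gamma>)"

lemma Lindenbaum:
  assumes "\<not> CS \<turnstile>\<^sub>J\<^sub>E F"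
  obtains \<Gamma> where "maximal_avoiding CS F \<Gamma>"
proof -
  let ?A = "{\<Gamma>. \<not> derives CS \<Gamma> F}"
  have "\<exists>\<Gamma>\<in>?A. \<forall>\<Delta>\<in>?A. \<Gamma> \<subseteq> \<Delta> \<longrightarrow> \<Delta> = \<Gamma>"
  proof (rule subset_Zorn_nonempty)
    show "?A \<noteq> {}" using assms derives_empty by blast
  next
    fix \<C> assume C: "\<C> \<noteq> {}" "subset.chain ?A \<C>"
    then show "\<Union>\<C> \<in> ?A"
      using derives_Union_chain[OF _ C] by (auto simp: subset_chain_def)
  qed
  then show ?thesis using that by (auto simp: maximal_avoiding_def)
qed

context
  fixes CS :: "'p cs" and F :: "'p fm" and \<Gamma> :: "'p fm set"
  assumes max: "maximal_avoiding CS F \<Gamma>"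
begin

text \<open>Adjoining \<open>G\<close> properly enlarges \<Gamma>, hence makes \<open>F\<close>
  derivable; the deduction theorem then discharges \<open>G\<close>.\<close>

lemma maximal_nonmember: "G \<notin> \<Gamma> \<Longrightarrow> derives CS \<Gamma> (G \<^bold>\<rightarrow> F)"
  using max by (metis deduction insertI1 maximal_avoiding_def subset_insertI)

lemma maximal_closed: "derives CS \<Gamma> G \<Longrightarrow> G \<in> \<Gamma>"
  using max maximal_nonmember derives.mp by (metis maximal_avoiding_def)

lemma maximal_provable: "CS \<turnstile>\<^sub>J\<^sub>E G \<Longrightarrow> G \<in> \<Gamma>"
  by (simp add: derives.provable maximal_closed)

lemma maximal_avoids: "F \<notin> \<Gamma>"
  using max derives.assumption by (auto simp: maximal_avoiding_def)

lemma maximal_Falsum: "Falsum \<notin> \<Gamma>"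
  using maximal_avoids maximal_closed derives_exfalso by (meson derives.assumption derives.mp)

lemma maximal_Imp: "(G \<^bold>\<rightarrow> H) \<in> \<Gamma> \<longleftrightarrow> G \<notin> \<Gamma> \<or> H \<in> \<Gamma>"
proof
  assume "(G \<^bold>\<rightarrow> H) \<in> \<Gamma>"
  then show "G \<notin> \<Gamma> \<or> H \<in> \<Gamma>"
    by (meson derives.assumption derives.mp maximal_closed)
next
  assume "G \<notin> \<Gamma> \<or> H \<in> \<Gamma>"
  then show "(G \<^bold>\<rightarrow> H) \<in> \<Gamma>"
  proof
    assume "H \<in> \<Gamma>"
    then show ?thesis by (meson derives.assumption derives.mp derives_K maximal_closed)
  next
    assume "G \<notin> \<Gamma>"
    \<comment> \<open>If the implication were missing as well, then \<open>G\<close> and the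
      implication would each imply \<open>F\<close>, and the classical case split
      \<open>derives_cases\<close> would put \<open>F\<close> into \<Gamma>.\<close>
    then show ?thesis
      by (meson derives.mp derives_cases maximal_avoids maximal_closed maximal_nonmember)
  qed
qed

lemma maximal_axiom: "JE_axiom G \<Longrightarrow> G \<in> \<Gamma>"
  by (simp add: JE_provable.Ax maximal_provable)

definition canonical_evaluation :: "'p evaluation" where
  "canonical_evaluation =
     \<lparr>val = (\<lambda>P. Atom P \<in> \<Gamma>), pev = (\<lambda>l. {G. Prf l G \<in> \<Gamma>}), jev = (\<lambda>t. {G. Just t G \<in> \<Gamma>})\<rparr>"

text \<open>Every closure condition comes from an axiom lying in \<Gamma>, read through
  \<open>maximal_Imp\<close>; the condition on \<open>CS\<close> comes from axiom
  necessitation.\<close>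

lemma basic_evaluation_canonical: "basic_evaluation CS canonical_evaluation"
  unfolding basic_evaluation_def canonical_evaluation_def fm_app_def fm_odot_def
  using maximal_axiom[OF JE_axiom.j] maximal_axiom[OF JE_axiom.jplus]
    maximal_axiom[OF JE_axiom.j4] maximal_axiom[OF JE_axiom.je]
    maximal_axiom[OF JE_axiom.jeplus] maximal_provable[OF JE_provable.AN]
  by (auto simp: maximal_Imp maximal_Falsum) blast+

text \<open>\<open>undefined\<close> stands for some element of \<open>'w\<close>, which exists
  because HOL types are nonempty.\<close>

definition canonical_model :: "('w, 'p) model" where
  "canonical_model =
     \<lparr>worlds = {undefined}, nbhd = (\<lambda>_. Pow {undefined}), evl = (\<lambda>_. canonical_evaluation)\<rparr>"

text \<open>Only implication uses the induction hypotheses: \<open>Prf\<close> and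
  \<open>Just\<close> formulas are evaluated by membership and never look at the truth of their
  bodies. The world \<open>w\<close> is arbitrary because \<open>evl\<close> is constant.\<close>

lemma truth_lemma: "holds canonical_model w G \<longleftrightarrow> G \<in> \<Gamma>"
  by (induction G)
    (auto simp: canonical_model_def canonical_evaluation_def maximal_Imp maximal_Falsum)

lemma modular_model_canonical: "modular_model CS canonical_model"
proof -
  \<comment> \<open>Through the truth lemma, factivity becomes closure of \<Gamma> under axiom
    \<open>jt\<close>.\<close>
  have "factive canonical_model"
    unfolding factive_def truth_lemma
    using maximal_axiom[OF JE_axiom.jt] by (auto simp: maximal_Imp)
  then show ?thesis
    using basic_evaluation_canonical
    by (auto simp: modular_model_def quasi_model_def justification_yields_belief_def
        canonical_model_def truth_set_def)
qed

lemma not_valid_in_canonical: "\<not> valid_in canonical_model F"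
  \<comment> \<open>The model is unfolded only after \<open>truth_lemma\<close> has been applied to
    the folded constant; what is left is that a world exists.\<close>
  by (simp add: valid_in_def truth_lemma maximal_avoids) (simp add: canonical_model_def)

end

theorem mainTheorem2:
  fixes CS :: "('p::countable) cs" and F :: "'p fm"
  assumes "constant_specification CS"
  shows "CS \<turnstile>\<^sub>J\<^sub>E F \<longleftrightarrow>
    (\<forall>M :: ('w, 'p) model. modular_model CS M \<longrightarrow> valid_in M F)"
proof
  assume "CS \<turnstile>\<^sub>J\<^sub>E F"
  then show "\<forall>M :: ('w, 'p) model. modular_model CS M \<longrightarrow> valid_in M F"
    by (simp add: JE_sound)
next
  assume valid: "\<forall>M :: ('w, 'p) model. modular_model CS M \<longrightarrow> valid_in M F"
  show "CS \<turnstile>\<^sub>J\<^sub>E F"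
  proof (rule ccontr)
    assume "\<not> CS \<turnstile>\<^sub>J\<^sub>E F"
    then obtain \<Gamma> where "maximal_avoiding CS F \<Gamma>" by (rule Lindenbaum)
    then show False
      using valid modular_model_canonical not_valid_in_canonical by blast
  qed
qed

end
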